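(* Let $X$ and $U$ be real Hilbert spaces, let $A:X\supset D(A)\to X$ be a linear maximal monotone operator, and let $B\in L(U,X)$ be a bounded linear operator with adjoint $B^*$. Let $F\subset U$ be closed and convex with orthogonal projection $P_F:U\to U$, and let $(x^\star,u^\star)\in D(A)\times\operatorname{int}F$ be a controlled equilibrium of $(A,B)$, i.e. $-Ax^\star+Bu^\star=0$. If $(A,B)$ is exponentially detectable, then the nonlinear closed-loop system $(A_{\mathrm{cl}},B)$ with $$A_{\mathrm{cl}}:X\supset D(A)\to X,\qquad A_{\mathrm{cl}}(x)=Ax-B\,P_F\big(u^\star-B^*(x-x^\star)\big),$$ fulfills the VOVS property at $x^\star$.
   Context: An operator $W:X\supset D(W)\to X$ is monotone if $\langle W(x)-W(z),x-z\rangle_X\ge 0$ for all $x,z\in D(W)$; it is maximal monotone if it admits no proper monotone extension, equivalently if it is monotone and $\lambda I+W$ is onto $X$ for some (hence all) $\lambda>0$. For a maximal monotone $W$, the semigroup generated by $-W$ is the family of nonexpansive mappings $S(t):\overline{D(W)}\to\overline{D(W)}$, $t\ge0$, given by $S(t)x_0=\lim_{n\to\infty}(I+\tfrac tn W)^{-n}x_0$; $t\mapsto S(t)x_0$ is the unique mild solution of $\dot x=-W(x)$, $x(0)=x_0$. The operator $A_{\mathrm{cl}}$ is maximal monotone. Exponential detectability: $(A,B)$ (with dynamics $\dot x=-Ax+Bu$ and output $y=B^*x$) is exponentially detectable if there exists $L\in L(U,X)$ such that $-A+LB^*$ generates an exponentially stable strongly continuous semigroup $(T(t))_{t\ge0}$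 on $X$, i.e. $\|T(t)\|\le c e^{-\omega t}$ for all $t\ge0$ with some $c\ge1$, $\omega>0$. Vanishing output vanishing state (VOVS) property: for a maximal monotone operator $W$ with semigroup $(S(t))_{t\ge0}$ generated by $-W$ and $B\in L(U,X)$, the system $(W,B)$ fulfills the VOVS property at $x^\star$ if for all $x_0\in\overline{D(W)}$: $\lim_{t\to\infty}B^*(S(t)x_0-x^\star)=0$ implies $\lim_{t\to\infty}S(t)x_0=x^\star$. *)

theory Defs
  imports "HOL-Analysis.Analysis"
begin

text \<open>Real Hilbert spaces are types of sort \<open>{real_inner, banach}\<close>. A single-valued operator
  \<open>W : X \<supset> D(W) \<rightarrow> X\<close> is given by its domain \<open>D\<close> and a total function \<open>W\<close>; only the values
  of \<open>W\<close> on \<open>D\<close> are relevant.\<close>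

definition op_graph :: "'x set \<Rightarrow> ('x \<Rightarrow> 'y) \<Rightarrow> ('x \<times> 'y) set" where
  "op_graph D W = {(x, W x) | x. x \<in> D}"

definition linear_operator :: "'x::real_vector set \<Rightarrow> ('x \<Rightarrow> 'x) \<Rightarrow> bool" where
  "linear_operator D A \<longleftrightarrow> subspace D \<and>
     (\<forall>x\<in>D. \<forall>y\<in>D. A (x + y) = A x + A y) \<and>
     (\<forall>c. \<forall>x\<in>D. A (c *\<^sub>R x) = c *\<^sub>R A x)"

definition monotone_graph :: "('x::real_inner \<times> 'x) set \<Rightarrow> bool" where
  "monotone_graph G \<longleftrightarrow> (\<forall>(x, v)\<in>G. \<forall>(z, w)\<in>G. (v - w) \<bullet> (x - z) \<ge> 0)"

text \<open>Extensions range over arbitrary, possibly multivalued, monotone graphs. This is needed for the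
  equivalence with the range condition: \<open>sgn\<close> on the reals has no proper single-valued
  monotone extension, but \<open>I + sgn\<close> is not onto.\<close>

definition maximal_monotone :: "'x::real_inner set \<Rightarrow> ('x \<Rightarrow> 'x) \<Rightarrow> bool" where
  "maximal_monotone D W \<longleftrightarrow> monotone_graph (op_graph D W) \<and>
     (\<forall>G. monotone_graph G \<and> op_graph D W \<subseteq> G \<longrightarrow> G = op_graph D W)"

text \<open>\<open>resolvent l D W\<close> is \<open>(I + l W)\<^sup>-\<^sup>1\<close>.\<close>

definition resolvent :: "real \<Rightarrow> 'x::real_inner set \<Rightarrow> ('x \<Rightarrow> 'x) \<Rightarrow> 'x \<Rightarrow> 'x" where
  "resolvent l D W = inv_into D (\<lambda>z. z + l *\<^sub>R W z)"

text \<open>The value \<open>S(0) = I\<close> is set separately, since \<open>I + 0 W\<close> has domain \<open>D\<close> and is not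
  invertible at points of \<open>closure D - D\<close>.\<close>

definition nonlinear_semigroup :: "'x::real_inner set \<Rightarrow> ('x \<Rightarrow> 'x) \<Rightarrow> real \<Rightarrow> 'x \<Rightarrow> 'x" where
  "nonlinear_semigroup D W t x0 =
     (if t = 0 then x0 else lim (\<lambda>n. (resolvent (t / real n) D W ^^ n) x0))"

definition VOVS ::
  "'x::real_inner set \<Rightarrow> ('x \<Rightarrow> 'x) \<Rightarrow> ('u::real_inner \<Rightarrow>\<^sub>L 'x) \<Rightarrow> 'x \<Rightarrow> bool" where
  "VOVS D W B xs \<longleftrightarrow> (\<forall>x0 \<in> closure D.
     ((\<lambda>t. adjoint (blinfun_apply B) (nonlinear_semigroup D W t x0 - xs)) \<longlongrightarrow> 0) at_top \<longrightarrow>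
     ((\<lambda>t. nonlinear_semigroup D W t x0) \<longlongrightarrow> xs) at_top)"

text \<open>Only the values of \<open>T\<close> at nonnegative times are relevant.\<close>

definition strongly_continuous_semigroup :: "(real \<Rightarrow> 'x::real_normed_vector \<Rightarrow>\<^sub>L 'x) \<Rightarrow> bool" where
  "strongly_continuous_semigroup T \<longleftrightarrow> T 0 = id_blinfun \<and>
     (\<forall>s\<ge>0. \<forall>t\<ge>0. T (s + t) = T s o\<^sub>L T t) \<and>
     (\<forall>x. ((\<lambda>t. T t x) \<longlongrightarrow> x) (at_right 0))"

definition generator_graph :: "(real \<Rightarrow> 'x::real_normed_vector \<Rightarrow>\<^sub>L 'x) \<Rightarrow> ('x \<times> 'x) set" where
  "generator_graph T = {(x, y). ((\<lambda>t. (T t x - x) /\<^sub>R t) \<longlongrightarrow> y) (at_right 0)}"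

definition generates ::
  "'x::real_normed_vector set \<Rightarrow> ('x \<Rightarrow> 'x) \<Rightarrow> (real \<Rightarrow> 'x \<Rightarrow>\<^sub>L 'x) \<Rightarrow> bool" where
  "generates D G T \<longleftrightarrow> strongly_continuous_semigroup T \<and> generator_graph T = op_graph D G"

definition exponentially_stable :: "(real \<Rightarrow> 'x::real_normed_vector \<Rightarrow>\<^sub>L 'x) \<Rightarrow> bool" where
  "exponentially_stable T \<longleftrightarrow>
     (\<exists>c\<ge>1. \<exists>\<omega>>0. \<forall>t\<ge>0. norm (T t) \<le> c * exp (- \<omega> * t))"

definition exponentially_detectable ::
  "'x::real_inner set \<Rightarrow> ('x \<Rightarrow> 'x) \<Rightarrow> ('u::real_inner \<Rightarrow>\<^sub>L 'x) \<Rightarrow> bool" where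
  "exponentially_detectable D A B \<longleftrightarrow>
     (\<exists>L :: 'u \<Rightarrow>\<^sub>L 'x. \<exists>T.
        generates D (\<lambda>x. - A x + L (adjoint (blinfun_apply B) x)) T \<and> exponentially_stable T)"

text \<open>Same formula as \<^const>\<open>closest_point\<close>, whose type is restricted to Heine-Borel spaces.\<close>

definition metric_projection :: "'u::real_inner set \<Rightarrow> 'u \<Rightarrow> 'u" where
  "metric_projection F u = (SOME p. p \<in> F \<and> (\<forall>q\<in>F. dist u p \<le> dist u q))"

definition closed_loop ::
  "('x::real_inner \<Rightarrow> 'x) \<Rightarrow> ('u::real_inner \<Rightarrow>\<^sub>L 'x) \<Rightarrow> 'u set \<Rightarrow> 'x \<Rightarrow> 'u \<Rightarrow> 'x \<Rightarrow> 'x" where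
  "closed_loop A B F xs us x =
     A x - B (metric_projection F (us - adjoint (blinfun_apply B) (x - xs)))"

end

theory Submission
  imports Defs
begin

text \<open>
  Put \<open>G = - A + L B\<^sup>*\<close>, which generates an exponentially stable semigroup \<open>T\<close>. Since \<open>x\<^sup>\<star>\<close> is an
  equilibrium and \<open>P\<^sub>F u\<^sup>\<star> = u\<^sup>\<star>\<close>, the deviation \<open>z = x - x\<^sup>\<star>\<close> of a closed-loop trajectory solves
  \<open>z' = G z + f\<close> with \<open>f = B (P\<^sub>F (u\<^sup>\<star> - B\<^sup>* z) - u\<^sup>\<star>) - L B\<^sup>* z\<close>. The projection is nonexpansive, so
  \<open>|f| \<le> (|L| + |B|) |B\<^sup>* z|\<close>: the perturbation vanishes with the output. A stable linear system
  driven by a vanishing input has a vanishing state.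

  The semigroup is a limit of implicit Euler steps, and the argument is carried out on these steps.
  One step of length \<open>h\<close> reads \<open>z\<^sub>k - h G z\<^sub>k = z\<^sub>k\<^sub>-\<^sub>1 + h f\<^sub>k\<close>. In the equivalent norm
  \<open>sup\<^sub>t exp (\<omega> t) |T t x|\<close> the operator \<open>G + \<omega>\<close> is dissipative (\<open>stable_norm_dissipative\<close>), so each
  step contracts by the factor \<open>1 / (1 + \<omega> h)\<close> up to the input \<open>f\<^sub>k\<close>
  (\<open>closed_loop_step_bound\<close>), and the scalar recursion \<open>discrete_gronwall\<close> bounds the last iterate.
  This replaces the variation of constants formula and needs no vector-valued integrals.

  Two facts about the closed loop make the passage to the limit legitimate. First, implicit Euler
  steps exist: \<open>I + h A\<close> is onto because \<open>A\<close> is linear and maximal monotone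
  (\<open>linear_maximal_monotone_range\<close>), and the Lipschitz feedback is absorbed by a fixed point
  argument when \<open>h\<close> is small (\<open>lipschitz_perturbation_range\<close>). Second, the Euler polygons converge
  to the semigroup uniformly on compact time intervals (\<open>exponential_formula_rate\<close>), so the outputs
  of the discrete trajectory are small as soon as those of the semigroup are. That convergence is
  the Crandall-Liggett theorem; \<open>resolvent_power_comparison\<close> proves it from a comparison of iterates
  with two different step lengths, in the form found by Kobayashi.
\<close>

section \<open>Projections and adjoints in Hilbert space\<close>

text \<open>Without local compactness, existence comes from completeness: by the parallelogram identity,
  the sets of almost closest points have diameters tending to zero.\<close>

lemma closest_point_exists:
  fixes F :: "'u::{real_inner, banach} set"
  assumes "closed F" "convex F" "F \<noteq> {}"
  shows "\<exists>p\<in>F. \<forall>q\<in>F. dist u p \<le> dist u q"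
proof -
  define d where "d = infdist u F"
  have d0: "d \<ge> 0" by (simp add: d_def infdist_nonneg)
  have dle: "d \<le> dist u q" if "q \<in> F" for q
    using that by (simp add: d_def infdist_le)
  define S where "S n = {p \<in> F. dist u p \<le> d + 1 / real (Suc n)}" for n
  have Seq: "S n = F \<inter> cball u (d + 1 / real (Suc n))" for n
    by (auto simp: S_def)
  have closed_S: "closed (S n)" for n
    unfolding Seq using assms(1) by (intro closed_Int) auto
  have S_ne: "S n \<noteq> {}" for n
  proof -
    have "\<exists>p\<in>F. dist u p < d + 1 / real (Suc n)"
    proof (rule ccontr)
      assume "\<not> ?thesis"
      then have "d + 1 / real (Suc n) \<le> infdist u F"
        using assms(3) by (auto simp: infdist_def not_less intro!: cINF_greatest)
      then show False by (simp add: d_def)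
    qed
    then show ?thesis by (auto simp: S_def intro: less_imp_le)
  qed
  have S_mono: "S n \<subseteq> S m" if "m \<le> n" for m n
  proof -
    have "1 / real (Suc n) \<le> 1 / real (Suc m)" using that by (simp add: frac_le)
    then show ?thesis unfolding S_def by auto
  qed
  have small: "\<exists>n. \<forall>p\<in>S n. \<forall>q\<in>S n. dist p q < e" if "e > 0" for e
  proof -
    have "(\<lambda>n. 4 * ((d + 1 / real (Suc n))\<^sup>2 - d\<^sup>2)) \<longlonglongrightarrow> 4 * ((d + 0)\<^sup>2 - d\<^sup>2)"
      by (intro tendsto_intros LIMSEQ_Suc[OF lim_1_over_n])
    then have "\<forall>\<^sub>F n in sequentially. 4 * ((d + 1 / real (Suc n))\<^sup>2 - d\<^sup>2) < e\<^sup>2"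
      using that by (intro order_tendstoD(2)) auto
    then obtain n where n: "4 * ((d + 1 / real (Suc n))\<^sup>2 - d\<^sup>2) < e\<^sup>2"
      by (auto simp: eventually_sequentially)
    have "dist p q < e" if "p \<in> S n" "q \<in> S n" for p q
    proof -
      define r where "r = d + 1 / real (Suc n)"
      define m where "m = (1/2) *\<^sub>R p + (1/2) *\<^sub>R q"
      have "m \<in> F" using that assms(2) by (auto simp: m_def S_def convex_def)
      then have "d\<^sup>2 \<le> (norm (u - m))\<^sup>2"
        using dle[of m] d0 by (auto simp: dist_norm intro: power_mono)
      moreover have "(norm (u - p))\<^sup>2 \<le> r\<^sup>2" "(norm (u - q))\<^sup>2 \<le> r\<^sup>2"
        using that by (auto simp: S_def r_def dist_norm intro!: power_mono)
      moreover have "(norm (p - q))\<^sup>2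
          = 2 * (norm (u - p))\<^sup>2 + 2 * (norm (u - q))\<^sup>2 - 4 * (norm (u - m))\<^sup>2"
        by (simp add: m_def power2_norm_eq_inner inner_simps inner_commute field_simps)
      ultimately have "(norm (p - q))\<^sup>2 < e\<^sup>2" using n[folded r_def] by argo
      then show ?thesis using \<open>e > 0\<close> by (simp add: dist_norm power2_less_imp_less)
    qed
    then show ?thesis by blast
  qed
  obtain p where p: "\<And>n. p \<in> S n"
    using decreasing_closed_nest[of S, OF closed_S S_ne S_mono small] by blast
  have "(\<lambda>n. d + 1 / real (Suc n)) \<longlonglongrightarrow> d + 0"
    by (intro tendsto_intros LIMSEQ_Suc[OF lim_1_over_n])
  then have "dist u p \<le> d"
    using p by (intro LIMSEQ_le_const[of _ d]) (auto simp: S_def)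
  moreover have "p \<in> F" using p[of 0] by (simp add: S_def)
  ultimately show ?thesis using dle by force
qed

context
  fixes F :: "'u::{real_inner, banach} set"
  assumes F: "closed F" "convex F" "F \<noteq> {}"
begin

lemma metric_projection:
  "metric_projection F u \<in> F" "q \<in> F \<Longrightarrow> dist u (metric_projection F u) \<le> dist u q"
proof -
  have "metric_projection F u \<in> F \<and> (\<forall>q\<in>F. dist u (metric_projection F u) \<le> dist u q)"
    unfolding metric_projection_def
    by (rule someI_ex) (use closest_point_exists[OF F, of u] in blast)
  then show "metric_projection F u \<in> F" "q \<in> F \<Longrightarrow> dist u (metric_projection F u) \<le> dist u q"
    by auto
qed

lemma metric_projection_variational:
  assumes "q \<in> F"
  shows "(u - metric_projection F u) \<bullet> (q - metric_projection F u) \<le> 0"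
  using any_closest_point_dot[OF F(2,1) _ assms, of "metric_projection F u" u] metric_projection
  by blast

lemma metric_projection_firmly_nonexpansive:
  "(norm (metric_projection F a - metric_projection F b))\<^sup>2
     \<le> (metric_projection F a - metric_projection F b) \<bullet> (a - b)"
  using metric_projection_variational[of "metric_projection F b" a]
    metric_projection_variational[of "metric_projection F a" b] metric_projection(1)
  by (simp add: power2_norm_eq_inner inner_simps inner_commute)

lemma metric_projection_nonexpansive:
  "norm (metric_projection F a - metric_projection F b) \<le> norm (a - b)"
proof -
  have "(norm (metric_projection F a - metric_projection F b))\<^sup>2
      \<le> norm (metric_projection F a - metric_projection F b) * norm (a - b)"
    using metric_projection_firmly_nonexpansive[of a b] norm_cauchy_schwarz order_trans by blast
  then show ?thesis
    by (cases "norm (metric_projection F a - metric_projection F b) = 0")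
       (auto simp: power2_eq_square)
qed

lemma metric_projection_fixes: "u \<in> F \<Longrightarrow> metric_projection F u = u"
  using metric_projection(2)[of u u] by simp

end

text \<open>On a subspace both \<open>p + q\<close> and \<open>p - q\<close> compete with the closest point \<open>p\<close>, so the variational
  inequality becomes an equation.\<close>

lemma metric_projection_subspace_orthogonal:
  fixes K :: "'u::{real_inner, banach} set"
  assumes "closed K" "subspace K" "q \<in> K"
  shows "(u - metric_projection K u) \<bullet> q = 0"
proof -
  have K: "closed K" "convex K" "K \<noteq> {}"
    using assms subspace_imp_convex by auto
  let ?p = "metric_projection K u"
  have p: "?p \<in> K" by (rule metric_projection[OF K])
  have "(u - ?p) \<bullet> ((?p + q) - ?p) \<le> 0" "(u - ?p) \<bullet> ((?p - q) - ?p) \<le> 0"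
    using p assms
    by (intro metric_projection_variational[OF K] subspace_add subspace_diff; simp)+
  then show ?thesis by simp
qed

text \<open>Needed because \<^const>\<open>adjoint\<close> is a choice of some adjoint map, which must be shown to exist.
  The representing vector is a multiple of a vector orthogonal to the kernel of \<open>f\<close>.\<close>

lemma riesz_representation:
  fixes f :: "'x::{real_inner, banach} \<Rightarrow> real"
  assumes "bounded_linear f"
  shows "\<exists>v. \<forall>x. f x = x \<bullet> v"
proof (cases "\<forall>x. f x = 0")
  case True
  then show ?thesis by (intro exI[of _ 0]) simp
next
  case False
  then obtain u where u: "f u \<noteq> 0" by blast
  interpret f: bounded_linear f by fact
  define K where "K = {x. f x = 0}"
  have K: "closed K" "subspace K"
    using closed_vimage[OF closed_singleton[of 0] f.continuous_on[OF continuous_on_id]]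
    by (auto simp: K_def vimage_def subspace_def f.add f.scaleR f.zero)
  let ?p = "metric_projection K u"
  have "convex K" "K \<noteq> {}" using K(2) subspace_imp_convex subspace_0 by blast+
  then have "?p \<in> K" by (rule metric_projection(1)[OF K(1)])
  define w where "w = u - ?p"
  have fw: "f w = f u" using \<open>?p \<in> K\<close> by (simp add: w_def f.diff K_def)
  then have w0: "w \<noteq> 0" using u f.zero by auto
  have orth: "w \<bullet> q = 0" if "q \<in> K" for q
    unfolding w_def by (rule metric_projection_subspace_orthogonal[OF K that])
  show ?thesis
  proof (intro exI allI)
    fix x
    have "x - (f x / f w) *\<^sub>R w \<in> K"
      using fw u by (simp add: K_def f.diff f.scaleR)
    from orth[OF this] have "w \<bullet> x = (f x / f w) * (w \<bullet> w)" by (simp add: inner_simps)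
    then show "f x = x \<bullet> ((f w / (w \<bullet> w)) *\<^sub>R w)"
      using w0 fw u by (simp add: inner_commute)
  qed
qed

context
  fixes B :: "'u::{real_inner, banach} \<Rightarrow>\<^sub>L 'x::real_inner"
begin

lemma blinfun_adjoint: "B u \<bullet> x = u \<bullet> adjoint (blinfun_apply B) x"
proof -
  have "\<exists>v. \<forall>u. B u \<bullet> x = u \<bullet> v" for x
    by (intro riesz_representation bounded_linear_inner_left_comp blinfun.bounded_linear_right)
  then have "\<exists>g. \<forall>u x. B u \<bullet> x = u \<bullet> g x" by metis
  from someI_ex[OF this] show ?thesis unfolding adjoint_def by blast
qed

lemma linear_blinfun_adjoint: "linear (adjoint (blinfun_apply B))"
proof (rule linearI)
  show "adjoint (blinfun_apply B) (x + y)
      = adjoint (blinfun_apply B) x + adjoint (blinfun_apply B) y" for x y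
    by (rule vector_eq_ldot[THEN iffD1]) (simp add: inner_add_right flip: blinfun_adjoint)
  show "adjoint (blinfun_apply B) (c *\<^sub>R x) = c *\<^sub>R adjoint (blinfun_apply B) x" for c x
    by (rule vector_eq_ldot[THEN iffD1]) (simp add: inner_add_right flip: blinfun_adjoint)
qed

lemma norm_blinfun_adjoint_le: "norm (adjoint (blinfun_apply B) x) \<le> norm B * norm x"
proof -
  let ?y = "adjoint (blinfun_apply B) x"
  have "(norm ?y)\<^sup>2 = B ?y \<bullet> x" by (simp add: power2_norm_eq_inner blinfun_adjoint)
  also have "\<dots> \<le> norm (B ?y) * norm x" by (rule norm_cauchy_schwarz)
  also have "\<dots> \<le> norm B * norm ?y * norm x" by (intro mult_right_mono norm_blinfun) auto
  finally show ?thesis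
    by (cases "norm ?y = 0") (auto simp: power2_eq_square mult_ac)
qed

end

section \<open>The range condition for linear maximal monotone operators\<close>

text \<open>Adding one pair that is monotonically related to the whole graph gives a monotone extension, so
  maximality puts the pair into the graph already.\<close>

lemma maximal_monotone_graph_memI:
  assumes "maximal_monotone D W"
    and "\<And>z. z \<in> D \<Longrightarrow> (w - W z) \<bullet> (x - z) \<ge> 0"
  shows "x \<in> D \<and> W x = w"
proof -
  let ?G = "insert (x, w) (op_graph D W)"
  have "monotone_graph ?G"
    unfolding monotone_graph_def
  proof (clarify, goal_cases)
    case (1 a v b v')
    have "(W z - w) \<bullet> (z - x) \<ge> 0" if "z \<in> D" for z
      using assms(2)[OF that] by (simp add: inner_simps)
    then show ?case
      using 1 assms by (auto simp: op_graph_def maximal_monotone_def monotone_graph_def)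
  qed
  then have "?G = op_graph D W"
    using assms(1) unfolding maximal_monotone_def by blast
  then have "(x, w) \<in> op_graph D W" by blast
  then show ?thesis by (auto simp: op_graph_def)
qed

lemma maximal_monotoneD:
  assumes "maximal_monotone D W" "x \<in> D" "z \<in> D"
  shows "(W x - W z) \<bullet> (x - z) \<ge> 0"
  using assms by (fastforce simp: maximal_monotone_def monotone_graph_def op_graph_def)

text \<open>The linear case of Minty's theorem. The range \<open>R\<close> of \<open>I + h A\<close> is a subspace. It is closed,
  because \<open>I + h A\<close> is expansive and the graph of \<open>A\<close> is closed by maximality. If \<open>v\<close> is orthogonal
  to \<open>R\<close>, the pair \<open>(v, v / h)\<close> is monotonically related to the graph: the mixed terms in
  \<open>(v / h - A z) \<bullet> (v - z)\<close> cancel by orthogonality. So \<open>A v = v / h\<close>, whence \<open>2 v\<close> lies in \<open>R\<close>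
  and \<open>v = 0\<close>.\<close>

lemma linear_maximal_monotone_range:
  fixes A :: "'x::{real_inner, banach} \<Rightarrow> 'x"
  assumes lin: "linear_operator D A" and mm: "maximal_monotone D A" and h: "h > 0"
  shows "\<exists>x\<in>D. x + h *\<^sub>R A x = y"
proof -
  have sub: "subspace D" and
    add: "\<And>x y. x \<in> D \<Longrightarrow> y \<in> D \<Longrightarrow> A (x + y) = A x + A y" and
    scale: "\<And>c x. x \<in> D \<Longrightarrow> A (c *\<^sub>R x) = c *\<^sub>R A x"
    using lin by (auto simp: linear_operator_def)
  have A0: "A 0 = 0" using scale[of 0 0] subspace_0[OF sub] by simp
  have diff: "A (x - y) = A x - A y" if "x \<in> D" "y \<in> D" for x y
    using add[of x "(-1) *\<^sub>R y"] scale[of y "-1"] that subspace_scale[OF sub, of y "-1"] by simp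
  have pos: "A x \<bullet> x \<ge> 0" if "x \<in> D" for x
    using maximal_monotoneD[OF mm that subspace_0[OF sub]] by (simp add: A0)
  have lower: "norm x \<le> norm (x + h *\<^sub>R A x)" if "x \<in> D" for x
  proof -
    have "norm x * norm x = x \<bullet> x" by (simp add: norm_eq_sqrt_inner)
    also have "\<dots> \<le> (x + h *\<^sub>R A x) \<bullet> x" using pos[OF that] h by (simp add: inner_simps)
    also have "\<dots> \<le> norm (x + h *\<^sub>R A x) * norm x" by (rule norm_cauchy_schwarz)
    finally show ?thesis by (cases "x = 0") auto
  qed
  define R where "R = (\<lambda>x. x + h *\<^sub>R A x) ` D"
  have subR: "subspace R"
    unfolding subspace_def
  proof (intro conjI ballI allI)
    show "0 \<in> R" using A0 subspace_0[OF sub] by (force simp: R_def)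
    show "a + b \<in> R" if "a \<in> R" "b \<in> R" for a b
    proof -
      obtain x z where "x \<in> D" "z \<in> D" "a = x + h *\<^sub>R A x" "b = z + h *\<^sub>R A z"
        using \<open>a \<in> R\<close> \<open>b \<in> R\<close> by (auto simp: R_def)
      then show ?thesis using subspace_add[OF sub]
        by (auto simp: R_def add algebra_simps intro!: image_eqI[of _ _ "x + z"])
    qed
    show "c *\<^sub>R a \<in> R" if "a \<in> R" for c a
    proof -
      obtain x where "x \<in> D" "a = x + h *\<^sub>R A x" using \<open>a \<in> R\<close> by (auto simp: R_def)
      then show ?thesis using subspace_scale[OF sub]
        by (auto simp: R_def scale algebra_simps intro!: image_eqI[of _ _ "c *\<^sub>R x"])
    qed
  qed
  have clR: "closed R"
    unfolding closed_sequential_limits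
  proof (intro allI impI, elim conjE)
    fix r l assume "\<forall>n. r n \<in> R" and rl: "r \<longlonglongrightarrow> l"
    then have "\<forall>n. \<exists>x\<in>D. r n = x + h *\<^sub>R A x" by (auto simp: R_def)
    then obtain x where xD: "\<And>n. x n \<in> D" and r: "\<And>n. r n = x n + h *\<^sub>R A (x n)" by metis
    have "Cauchy x"
    proof (rule metric_CauchyI)
      fix e :: real assume "e > 0"
      then obtain M where M: "\<forall>m\<ge>M. \<forall>n\<ge>M. dist (r m) (r n) < e"
        using LIMSEQ_imp_Cauchy[OF rl] by (auto simp: Cauchy_def)
      have "dist (x m) (x n) \<le> dist (r m) (r n)" for m n
      proof -
        have "r m - r n = (x m - x n) + h *\<^sub>R A (x m - x n)"
          by (simp add: r diff xD algebra_simps)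
        then show ?thesis
          using lower[OF subspace_diff[OF sub xD xD], of m n] by (simp add: dist_norm)
      qed
      with M show "\<exists>M. \<forall>m\<ge>M. \<forall>n\<ge>M. dist (x m) (x n) < e" by (meson le_less_trans)
    qed
    then obtain a where a: "x \<longlonglongrightarrow> a" using Cauchy_convergent convergent_def by blast
    define w where "w = (l - a) /\<^sub>R h"
    have Ax: "(\<lambda>n. A (x n)) \<longlonglongrightarrow> w"
    proof -
      have "(\<lambda>n. (r n - x n) /\<^sub>R h) \<longlonglongrightarrow> w" unfolding w_def by (intro tendsto_intros rl a)
      moreover have "(r n - x n) /\<^sub>R h = A (x n)" for n using h by (simp add: r)
      ultimately show ?thesis by simp
    qed
    have "a \<in> D \<and> A a = w"
    proof (rule maximal_monotone_graph_memI[OF mm])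
      fix z assume "z \<in> D"
      have "(\<lambda>n. (A (x n) - A z) \<bullet> (x n - z)) \<longlonglongrightarrow> (w - A z) \<bullet> (a - z)"
        by (intro tendsto_intros Ax a)
      then show "(w - A z) \<bullet> (a - z) \<ge> 0"
        by (rule LIMSEQ_le_const) (use maximal_monotoneD[OF mm xD \<open>z \<in> D\<close>] in auto)
    qed
    then have "l = a + h *\<^sub>R A a" "a \<in> D" using h by (auto simp: w_def)
    then show "l \<in> R" by (auto simp: R_def)
  qed
  define v where "v = y - metric_projection R y"
  have orth: "v \<bullet> (x + h *\<^sub>R A x) = 0" if "x \<in> D" for x
    unfolding v_def by (rule metric_projection_subspace_orthogonal[OF clR subR])
      (use that in \<open>simp add: R_def\<close>)
  have "v \<in> D \<and> A v = v /\<^sub>R h"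
  proof (rule maximal_monotone_graph_memI[OF mm])
    fix z assume z: "z \<in> D"
    have "v \<bullet> z = - (h * (v \<bullet> A z))" using orth[OF z] by (simp add: inner_simps)
    then have vz: "(v \<bullet> z) / h = - (v \<bullet> A z)" using h by simp
    have "(v /\<^sub>R h - A z) \<bullet> (v - z) = (v \<bullet> v) / h - (v \<bullet> z) / h - v \<bullet> A z + A z \<bullet> z"
      by (simp add: inner_diff_left inner_diff_right inner_commute[of "A z" v]
          right_diff_distrib divide_inverse mult.commute)
    then have "(v /\<^sub>R h - A z) \<bullet> (v - z) = (v \<bullet> v) / h + A z \<bullet> z"
      by (simp add: vz)
    then show "0 \<le> (v /\<^sub>R h - A z) \<bullet> (v - z)" using pos[OF z] h by simp
  qed
  then have "v \<bullet> (v + v) = 0" using orth[of v] h by simp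
  then have "v = 0" by (simp add: inner_add_right)
  moreover have "metric_projection R y \<in> R"
    using clR subspace_imp_convex[OF subR] subspace_0[OF subR]
    by (intro metric_projection) auto
  ultimately have "y \<in> R" by (simp add: v_def)
  then show ?thesis by (auto simp: R_def)
qed

text \<open>With \<open>R = (I + h W)\<^sup>-\<^sup>1\<close> nonexpansive, the equation \<open>x + h (W x + N x) = y\<close> is the fixed point
  equation \<open>x = R (y - h N x)\<close> of a contraction.\<close>

lemma lipschitz_perturbation_range:
  fixes W N :: "'x::{real_inner, banach} \<Rightarrow> 'x"
  assumes mono: "\<And>x z. x \<in> D \<Longrightarrow> z \<in> D \<Longrightarrow> (W x - W z) \<bullet> (x - z) \<ge> 0"
    and range: "\<And>y. \<exists>x\<in>D. x + h *\<^sub>R W x = y"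
    and lip: "\<And>x z. norm (N x - N z) \<le> M * norm (x - z)"
    and h: "h > 0" "h * M < 1" and M: "M \<ge> 0"
  shows "\<exists>x\<in>D. x + h *\<^sub>R (W x + N x) = y"
proof -
  obtain R where R: "\<And>y. R y \<in> D" "\<And>y. R y + h *\<^sub>R W (R y) = y"
    using range by metis
  have nonexp: "norm (R a - R b) \<le> norm (a - b)" for a b
  proof -
    have "a - b = (R a - R b) + h *\<^sub>R (W (R a) - W (R b))"
      using R(2)[of a] R(2)[of b] by (simp add: algebra_simps)
    then have "(a - b) \<bullet> (R a - R b)
        = (R a - R b) \<bullet> (R a - R b) + h * ((W (R a) - W (R b)) \<bullet> (R a - R b))"
      by (simp only: inner_add_left inner_scaleR_left)
    then have "(norm (R a - R b))\<^sup>2 \<le> (a - b) \<bullet> (R a - R b)"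
      using mono[OF R(1) R(1), of a b] h by (simp add: power2_norm_eq_inner)
    also have "\<dots> \<le> norm (a - b) * norm (R a - R b)" by (rule norm_cauchy_schwarz)
    finally show ?thesis by (cases "norm (R a - R b) = 0") (auto simp: power2_eq_square)
  qed
  have "\<exists>!x. R (y - h *\<^sub>R N x) = x"
  proof (rule banach_fix_type[of "h * M"])
    show "\<forall>x z. dist (R (y - h *\<^sub>R N x)) (R (y - h *\<^sub>R N z)) \<le> h * M * dist x z"
    proof (intro allI)
      fix x z
      have "dist (R (y - h *\<^sub>R N x)) (R (y - h *\<^sub>R N z)) \<le> norm (h *\<^sub>R (N z - N x))"
        using nonexp[of "y - h *\<^sub>R N x" "y - h *\<^sub>R N z"]
        by (simp add: dist_norm algebra_simps)
      also have "\<dots> \<le> h * (M * norm (z - x))"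
        using lip[of z x] h by (simp del: mult_le_cancel_left_pos add: mult_left_mono)
      finally show "dist (R (y - h *\<^sub>R N x)) (R (y - h *\<^sub>R N z)) \<le> h * M * dist x z"
        by (simp add: dist_norm norm_minus_commute mult.assoc)
    qed
  qed (use h M in auto)
  then obtain x where x: "R (y - h *\<^sub>R N x) = x" by blast
  then have "x \<in> D" "x + h *\<^sub>R W x = y - h *\<^sub>R N x"
    using R[of "y - h *\<^sub>R N x"] by auto
  then have "x \<in> D" "x + h *\<^sub>R (W x + N x) = y"
    by (auto simp: algebra_simps)
  then show ?thesis by blast
qed

section \<open>The exponential formula\<close>

lemma eventually_small_step:
  fixes h0 t :: real
  assumes "h0 > 0"
  shows "\<forall>\<^sub>F n in sequentially. t / real n \<le> h0"
  using order_tendstoD(2)[OF lim_const_over_n[of t] assms] by eventually_elim simp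

context
  fixes D :: "'x::real_inner set" and W :: "'x \<Rightarrow> 'x" and h0 :: real
  assumes mono: "\<And>x z. x \<in> D \<Longrightarrow> z \<in> D \<Longrightarrow> (W x - W z) \<bullet> (x - z) \<ge> 0"
    and range: "\<And>h y. 0 < h \<Longrightarrow> h \<le> h0 \<Longrightarrow> \<exists>x\<in>D. x + h *\<^sub>R W x = y"
begin

lemma resolvent_step:
  assumes "0 < h" "h \<le> h0"
  shows "resolvent h D W y \<in> D" "resolvent h D W y + h *\<^sub>R W (resolvent h D W y) = y"
proof -
  have "y \<in> (\<lambda>z. z + h *\<^sub>R W z) ` D" using range[OF assms, of y] by blast
  then show "resolvent h D W y \<in> D" "resolvent h D W y + h *\<^sub>R W (resolvent h D W y) = y"
    unfolding resolvent_def
    using inv_into_into[of y "\<lambda>z. z + h *\<^sub>R W z" D] f_inv_into_f[of y "\<lambda>z. z + h *\<^sub>R W z" D]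
    by auto
qed

lemma step_nonexpansive:
  assumes "0 \<le> h" "x \<in> D" "z \<in> D"
  shows "norm (x - z) \<le> norm ((x + h *\<^sub>R W x) - (z + h *\<^sub>R W z))"
proof -
  have "(norm (x - z))\<^sup>2 \<le> (x - z) \<bullet> (x - z) + h * ((W x - W z) \<bullet> (x - z))"
    using mono[OF assms(2,3)] assms(1) by (simp add: power2_norm_eq_inner)
  also have "\<dots> = ((x + h *\<^sub>R W x) - (z + h *\<^sub>R W z)) \<bullet> (x - z)"
    by (simp add: inner_simps algebra_simps)
  also have "\<dots> \<le> norm ((x + h *\<^sub>R W x) - (z + h *\<^sub>R W z)) * norm (x - z)"
    by (rule norm_cauchy_schwarz)
  finally show ?thesis
    by (cases "norm (x - z) = 0") (auto simp: power2_eq_square)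
qed

lemma resolvent_nonexpansive:
  assumes "0 < h" "h \<le> h0"
  shows "norm (resolvent h D W a - resolvent h D W b) \<le> norm (a - b)"
  using step_nonexpansive[of h "resolvent h D W a" "resolvent h D W b"]
    resolvent_step[OF assms] assms by simp

lemma resolvent_power_nonexpansive:
  assumes "0 < h" "h \<le> h0"
  shows "norm ((resolvent h D W ^^ n) a - (resolvent h D W ^^ n) b) \<le> norm (a - b)"
  by (induction n) (auto intro: order_trans[OF resolvent_nonexpansive[OF assms]])

lemma resolvent_power_displacement:
  assumes "0 < h" "h \<le> h0" "x \<in> D"
  shows "norm ((resolvent h D W ^^ n) x - x) \<le> real n * h * norm (W x)"
proof (induction n)
  case (Suc n)
  let ?J = "resolvent h D W"
  have "norm (?J x - x) \<le> norm (x - (x + h *\<^sub>R W x))"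
    using step_nonexpansive[of h "?J x" x] resolvent_step[OF assms(1,2), of x] assms by simp
  then have "norm (?J x - x) \<le> h * norm (W x)" using assms by simp
  moreover have "norm (?J ((?J ^^ n) x) - ?J x) \<le> real n * h * norm (W x)"
    using resolvent_nonexpansive[OF assms(1,2)] Suc order_trans by blast
  ultimately have "norm ((?J ((?J ^^ n) x) - ?J x) + (?J x - x))
      \<le> real n * h * norm (W x) + h * norm (W x)"
    by (intro norm_triangle_mono)
  then show ?case by (simp add: algebra_simps)
qed simp

text \<open>With \<open>p\<close>, \<open>q\<close> the two new iterates, expand \<open>|a - q|\<^sup>2\<close> and \<open>|p - b|\<^sup>2\<close> around \<open>|p - q|\<^sup>2\<close>: the
  linear terms, weighted by \<open>m\<close> and \<open>l\<close>, add up to \<open>2 l m (W p - W q) \<bullet> (p - q)\<close>, which is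
  nonnegative by monotonicity.\<close>

lemma resolvent_two_step:
  assumes l: "0 < l" "l \<le> h0" and m: "0 < m" "m \<le> h0"
  shows "(l + m) * (norm (resolvent l D W a - resolvent m D W b))\<^sup>2
    \<le> m * (norm (a - resolvent m D W b))\<^sup>2 + l * (norm (resolvent l D W a - b))\<^sup>2"
proof -
  define p where "p = resolvent l D W a"
  define q where "q = resolvent m D W b"
  define v where "v = W p"
  define w where "w = W q"
  have pq: "p \<in> D" "q \<in> D" "a = p + l *\<^sub>R v" "b = q + m *\<^sub>R w"
    using resolvent_step[OF l, of a] resolvent_step[OF m, of b]
    by (simp_all add: p_def q_def v_def w_def)
  have "(norm (a - q))\<^sup>2 = (norm (p - q))\<^sup>2 + 2 * l * (v \<bullet> (p - q)) + l\<^sup>2 * (norm v)\<^sup>2"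
    unfolding pq(3) power2_norm_eq_inner
    by (simp add: inner_simps inner_commute power2_eq_square algebra_simps)
  then have a: "(norm (a - q))\<^sup>2 \<ge> (norm (p - q))\<^sup>2 + 2 * l * (v \<bullet> (p - q))" by simp
  have "(norm (p - b))\<^sup>2 = (norm (p - q))\<^sup>2 - 2 * m * (w \<bullet> (p - q)) + m\<^sup>2 * (norm w)\<^sup>2"
    unfolding pq(4) power2_norm_eq_inner
    by (simp add: inner_simps inner_commute power2_eq_square algebra_simps)
  then have b: "(norm (p - b))\<^sup>2 \<ge> (norm (p - q))\<^sup>2 - 2 * m * (w \<bullet> (p - q))" by simp
  have "0 \<le> 2 * l * m * ((v - w) \<bullet> (p - q))"
    using mono[OF pq(1,2)] l m by (simp add: v_def w_def)
  also have "\<dots> = m * ((norm (p - q))\<^sup>2 + 2 * l * (v \<bullet> (p - q)))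
      + l * ((norm (p - q))\<^sup>2 - 2 * m * (w \<bullet> (p - q))) - (l + m) * (norm (p - q))\<^sup>2"
    by (simp add: inner_diff_left algebra_simps)
  also have "\<dots> \<le> m * (norm (a - q))\<^sup>2 + l * (norm (p - b))\<^sup>2 - (l + m) * (norm (p - q))\<^sup>2"
    using a b l m by (intro diff_right_mono add_mono mult_left_mono) auto
  finally show ?thesis by (simp add: p_def q_def)
qed

text \<open>The factor \<open>C j k\<close> in front of \<open>|W x|\<^sup>2\<close> is chosen so that it solves the recursion of the
  two-step inequality with equality, \<open>(l + m) C (j+1) (k+1) = m C j (k+1) + l C (j+1) k\<close>, and
  dominates the displacement bounds on the boundary \<open>j = 0\<close> or \<open>k = 0\<close>.\<close>

lemma resolvent_power_comparison:
  assumes l: "0 < l" "l \<le> h0" and m: "0 < m" "m \<le> h0" and x: "x \<in> D"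
  shows "(norm ((resolvent l D W ^^ j) x - (resolvent m D W ^^ k) x))\<^sup>2
    \<le> ((real j * l - real k * m)\<^sup>2 + real j * l\<^sup>2 + real k * m\<^sup>2) * (norm (W x))\<^sup>2"
proof (induction j arbitrary: k)
  case 0
  have "(norm (x - (resolvent m D W ^^ k) x))\<^sup>2 \<le> (real k * m * norm (W x))\<^sup>2"
    using resolvent_power_displacement[OF m x, of k]
    by (intro power_mono) (simp_all add: norm_minus_commute)
  also have "\<dots> \<le> ((real k * m)\<^sup>2 + real k * m\<^sup>2) * (norm (W x))\<^sup>2"
    unfolding power_mult_distrib by (intro mult_right_mono) auto
  finally show ?case by simp
next
  case (Suc j)
  show ?case
  proof (induction k)
    case 0
    have "(norm ((resolvent l D W ^^ Suc j) x - x))\<^sup>2 \<le> (real (Suc j) * l * norm (W x))\<^sup>2"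
      using resolvent_power_displacement[OF l x, of "Suc j"] by (intro power_mono) simp_all
    also have "\<dots> \<le> ((real (Suc j) * l)\<^sup>2 + real (Suc j) * l\<^sup>2) * (norm (W x))\<^sup>2"
      unfolding power_mult_distrib by (intro mult_right_mono) auto
    finally show ?case by simp
  next
    case (Suc k)
    let ?P = "\<lambda>j. (resolvent l D W ^^ j) x" and ?Q = "\<lambda>k. (resolvent m D W ^^ k) x"
    let ?C = "\<lambda>j k. (real j * l - real k * m)\<^sup>2 + real j * l\<^sup>2 + real k * m\<^sup>2"
    have "(l + m) * (norm (?P (Suc j) - ?Q (Suc k)))\<^sup>2
        \<le> m * (norm (?P j - ?Q (Suc k)))\<^sup>2 + l * (norm (?P (Suc j) - ?Q k))\<^sup>2"
      using resolvent_two_step[OF l m, of "?P j" "?Q k"] by simp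
    also have "\<dots> \<le> m * (?C j (Suc k) * (norm (W x))\<^sup>2) + l * (?C (Suc j) k * (norm (W x))\<^sup>2)"
      using Suc.IH \<open>\<And>k. (norm (?P j - ?Q k))\<^sup>2 \<le> ?C j k * (norm (W x))\<^sup>2\<close>[of "Suc k"] l m
      by (intro add_mono mult_left_mono) auto
    also have "\<dots> = (m * ?C j (Suc k) + l * ?C (Suc j) k) * (norm (W x))\<^sup>2"
      by (simp only: distrib_right mult.assoc)
    also have "m * ?C j (Suc k) + l * ?C (Suc j) k = (l + m) * ?C (Suc j) (Suc k)"
      by (simp add: power2_eq_square algebra_simps)
    finally have "(l + m) * (norm (?P (Suc j) - ?Q (Suc k)))\<^sup>2
        \<le> (l + m) * (?C (Suc j) (Suc k) * (norm (W x))\<^sup>2)" by (simp only: mult.assoc)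
    then show ?case using l m by (simp only: mult_le_cancel_left_pos add_pos_pos)
  qed
qed

text \<open>At equal times \<open>j l = k m = s\<close> the drift term \<open>(j l - k m)\<^sup>2\<close> disappears. A starting point
  outside the domain is approximated by \<open>y\<close> in the domain, at the cost of \<open>2 |x0 - y|\<close> by
  nonexpansivity.\<close>

lemma resolvent_power_comparison_same_time:
  assumes l: "0 < l" "l \<le> h0" and m: "0 < m" "m \<le> h0" and y: "y \<in> D"
    and s: "real j * l = s" "real k * m = s"
  shows "norm ((resolvent l D W ^^ j) x0 - (resolvent m D W ^^ k) x0)
    \<le> 2 * norm (x0 - y) + sqrt (s * (l + m)) * norm (W y)"
proof -
  let ?P = "resolvent l D W ^^ j" and ?Q = "resolvent m D W ^^ k"
  have s0: "s \<ge> 0" using l s(1) by auto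
  have "real j * l\<^sup>2 = s * l" "real k * m\<^sup>2 = s * m"
    using s by (simp_all add: power2_eq_square flip: mult.assoc)
  then have "(norm (?P y - ?Q y))\<^sup>2 \<le> (s * (l + m)) * (norm (W y))\<^sup>2"
    using resolvent_power_comparison[OF l m y, of j k] s by (simp add: distrib_left)
  also have "\<dots> = (sqrt (s * (l + m)) * norm (W y))\<^sup>2"
    using s0 l m by (simp add: power_mult_distrib)
  finally have "norm (?P y - ?Q y) \<le> sqrt (s * (l + m)) * norm (W y)"
    by (rule power2_le_imp_le) (use s0 l m in simp)
  moreover have "norm (?P x0 - ?P y) \<le> norm (x0 - y)" "norm (?Q y - ?Q x0) \<le> norm (x0 - y)"
    using resolvent_power_nonexpansive[OF l, of j x0 y]
      resolvent_power_nonexpansive[OF m, of k y x0] by (simp_all add: norm_minus_commute)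
  ultimately show ?thesis
    using norm_triangle_ineq[of "?P x0 - ?P y" "?P y - ?Q x0"]
      norm_triangle_ineq[of "?P y - ?Q y" "?Q y - ?Q x0"] by simp
qed

end

context
  fixes D :: "'x::{real_inner, banach} set" and W :: "'x \<Rightarrow> 'x" and h0 :: real
  assumes mono: "\<And>x z. x \<in> D \<Longrightarrow> z \<in> D \<Longrightarrow> (W x - W z) \<bullet> (x - z) \<ge> 0"
    and range: "\<And>h y. 0 < h \<Longrightarrow> h \<le> h0 \<Longrightarrow> \<exists>x\<in>D. x + h *\<^sub>R W x = y"
    and h0: "h0 > 0"
begin

lemma exponential_formula_converges:
  assumes x0: "x0 \<in> closure D" and s: "s > 0"
  shows "(\<lambda>n. (resolvent (s / real n) D W ^^ n) x0) \<longlonglongrightarrow> nonlinear_semigroup D W s x0"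
proof -
  let ?x = "\<lambda>n. (resolvent (s / real n) D W ^^ n) x0"
  have "Cauchy ?x"
  proof (rule metric_CauchyI)
    fix e :: real assume e: "e > 0"
    obtain y where y: "y \<in> D" "dist y x0 < e / 4"
      using x0 e unfolding closure_approachable by (meson divide_pos_pos zero_less_numeral)
    have "(\<lambda>n. sqrt (s * (s / real n + s / real n)) * norm (W y))
        \<longlonglongrightarrow> sqrt (s * (0 + 0)) * norm (W y)"
      by (intro tendsto_intros lim_const_over_n)
    then have "\<forall>\<^sub>F n in sequentially. sqrt (s * (s / real n + s / real n)) * norm (W y) < e / 2"
      using e by (intro order_tendstoD(2)) auto
    from eventually_conj[OF this eventually_conj[OF eventually_small_step[OF h0, of s] eventually_gt_at_top[of 0]]]
    obtain N where N: "sqrt (s * (s / real N + s / real N)) * norm (W y) < e / 2"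
        "s / real N \<le> h0" "N > 0"
      by (auto simp: eventually_sequentially)
    have "dist (?x i) (?x j) < e" if "i \<ge> N" "j \<ge> N" for i j
    proof -
      have le: "s / real i \<le> s / real N" "s / real j \<le> s / real N"
        using that N(3) s by (auto intro!: divide_left_mono)
      have pos: "0 < s / real i" "0 < s / real j" using that N(3) s by auto
      have "norm (?x i - ?x j)
          \<le> 2 * norm (x0 - y) + sqrt (s * (s / real i + s / real j)) * norm (W y)"
        using that N le pos y(1)
        by (intro resolvent_power_comparison_same_time[OF mono range]) auto
      also have "sqrt (s * (s / real i + s / real j)) \<le> sqrt (s * (s / real N + s / real N))"
        using le s by (intro real_sqrt_le_mono mult_left_mono add_mono) auto
      finally have "norm (?x i - ?x j)
          \<le> 2 * norm (x0 - y) + sqrt (s * (s / real N + s / real N)) * norm (W y)"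
        by (simp add: mult_right_mono)
      then show ?thesis using y(2) N(1) by (simp add: dist_norm norm_minus_commute)
    qed
    then show "\<exists>N. \<forall>i\<ge>N. \<forall>j\<ge>N. dist (?x i) (?x j) < e" by blast
  qed
  then have "?x \<longlonglongrightarrow> lim ?x" using Cauchy_convergent convergent_LIMSEQ_iff by blast
  then show ?thesis using s by (simp add: nonlinear_semigroup_def)
qed

lemma exponential_formula_rate:
  assumes x0: "x0 \<in> closure D" and y: "y \<in> D" and l: "0 < l" "l \<le> h0"
  shows "norm ((resolvent l D W ^^ k) x0 - nonlinear_semigroup D W (real k * l) x0)
    \<le> 2 * norm (x0 - y) + sqrt (real k * l * l) * norm (W y)"
proof (cases "k = 0")
  case True
  then show ?thesis by (simp add: nonlinear_semigroup_def)
next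
  case False
  define s where "s = real k * l"
  have s: "s > 0" using False l by (simp add: s_def)
  have "(\<lambda>n. norm ((resolvent l D W ^^ k) x0 - (resolvent (s / real n) D W ^^ n) x0))
      \<longlonglongrightarrow> norm ((resolvent l D W ^^ k) x0 - nonlinear_semigroup D W s x0)"
    by (intro tendsto_intros exponential_formula_converges x0 s)
  moreover have "(\<lambda>n. 2 * norm (x0 - y) + sqrt (s * (l + s / real n)) * norm (W y))
      \<longlonglongrightarrow> 2 * norm (x0 - y) + sqrt (s * (l + 0)) * norm (W y)"
    by (intro tendsto_intros lim_const_over_n)
  moreover have "\<forall>\<^sub>F n in sequentially.
      norm ((resolvent l D W ^^ k) x0 - (resolvent (s / real n) D W ^^ n) x0)
        \<le> 2 * norm (x0 - y) + sqrt (s * (l + s / real n)) * norm (W y)"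
    using eventually_small_step[OF h0, of s] eventually_gt_at_top[of 0]
  proof eventually_elim
    case (elim n)
    then show ?case using s l y s_def
      by (intro resolvent_power_comparison_same_time[OF mono range]) auto
  qed
  ultimately have "norm ((resolvent l D W ^^ k) x0 - nonlinear_semigroup D W s x0)
      \<le> 2 * norm (x0 - y) + sqrt (s * (l + 0)) * norm (W y)"
    using tendsto_le[OF sequentially_bot] by blast
  then show ?thesis by (simp add: s_def)
qed

end

section \<open>A norm adapted to an exponentially stable semigroup\<close>

text \<open>The standard renorming: since \<open>|T t x| \<le> c exp (- \<omega> t) |x|\<close>, this is a norm between \<open>|x|\<close> and
  \<open>c |x|\<close>, and in it the constant \<open>c\<close> of the decay estimate becomes \<open>1\<close>. Constants larger than \<open>1\<close>
  would accumulate over the Euler steps.\<close>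

definition stable_norm :: "(real \<Rightarrow> 'x::real_normed_vector \<Rightarrow>\<^sub>L 'x) \<Rightarrow> real \<Rightarrow> 'x \<Rightarrow> real" where
  "stable_norm T \<omega> x = (SUP t\<in>{0..}. exp (\<omega> * t) * norm (T t x))"

context
  fixes T :: "real \<Rightarrow> 'x::real_normed_vector \<Rightarrow>\<^sub>L 'x" and c \<omega> :: real
  assumes semigroup: "strongly_continuous_semigroup T"
    and decay: "\<And>t. t \<ge> 0 \<Longrightarrow> norm (T t) \<le> c * exp (- \<omega> * t)"
begin

lemma weighted_orbit_le: "t \<ge> 0 \<Longrightarrow> exp (\<omega> * t) * norm (T t x) \<le> c * norm x"
proof -
  assume "t \<ge> 0"
  have "exp (\<omega> * t) * norm (T t x) \<le> exp (\<omega> * t) * (c * exp (- \<omega> * t) * norm x)"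
    using norm_blinfun[of "T t" x] mult_right_mono[OF decay[OF \<open>t \<ge> 0\<close>], of "norm x"]
    by (intro mult_left_mono) auto
  also have "\<dots> = c * norm x" by (simp add: exp_minus field_simps)
  finally show ?thesis .
qed

lemma stable_norm_ge: "t \<ge> 0 \<Longrightarrow> exp (\<omega> * t) * norm (T t x) \<le> stable_norm T \<omega> x"
  unfolding stable_norm_def
  by (rule cSUP_upper) (auto intro!: bdd_aboveI[of _ "c * norm x"] weighted_orbit_le)

lemma stable_norm_least:
  "(\<And>t. t \<ge> 0 \<Longrightarrow> exp (\<omega> * t) * norm (T t x) \<le> b) \<Longrightarrow> stable_norm T \<omega> x \<le> b"
  unfolding stable_norm_def by (rule cSUP_least) auto

lemma norm_le_stable_norm: "norm x \<le> stable_norm T \<omega> x"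
  using stable_norm_ge[of 0 x] semigroup
  by (simp add: strongly_continuous_semigroup_def)

lemma stable_norm_le: "stable_norm T \<omega> x \<le> c * norm x"
  by (intro stable_norm_least weighted_orbit_le)

lemma stable_norm_triangle: "stable_norm T \<omega> (x + y) \<le> stable_norm T \<omega> x + stable_norm T \<omega> y"
proof (rule stable_norm_least)
  fix t :: real assume t: "t \<ge> 0"
  have "exp (\<omega> * t) * norm (T t (x + y))
      \<le> exp (\<omega> * t) * norm (T t x) + exp (\<omega> * t) * norm (T t y)"
    by (simp add: blinfun.add_right norm_triangle_ineq flip: distrib_left)
  then show "exp (\<omega> * t) * norm (T t (x + y)) \<le> stable_norm T \<omega> x + stable_norm T \<omega> y"
    using stable_norm_ge[OF t, of x] stable_norm_ge[OF t, of y] by linarith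
qed

lemma stable_norm_scale_le:
  assumes "a \<ge> 0"
  shows "stable_norm T \<omega> (a *\<^sub>R x) \<le> a * stable_norm T \<omega> x"
proof (rule stable_norm_least)
  fix t :: real assume t: "t \<ge> 0"
  have "exp (\<omega> * t) * norm (T t (a *\<^sub>R x)) = a * (exp (\<omega> * t) * norm (T t x))"
    using assms by (simp add: blinfun.scaleR_right)
  also have "\<dots> \<le> a * stable_norm T \<omega> x" using stable_norm_ge[OF t] assms by (rule mult_left_mono)
  finally show "exp (\<omega> * t) * norm (T t (a *\<^sub>R x)) \<le> a * stable_norm T \<omega> x" .
qed

lemma stable_norm_scale:
  assumes "a > 0"
  shows "stable_norm T \<omega> (a *\<^sub>R x) = a * stable_norm T \<omega> x"
proof (rule antisym)
  show "stable_norm T \<omega> (a *\<^sub>R x) \<le> a * stable_norm T \<omega> x"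
    using assms by (simp add: stable_norm_scale_le)
  have "a * stable_norm T \<omega> (inverse a *\<^sub>R (a *\<^sub>R x)) \<le> stable_norm T \<omega> (a *\<^sub>R x)"
    using stable_norm_scale_le[of "inverse a" "a *\<^sub>R x"] assms by (simp add: field_simps)
  then show "a * stable_norm T \<omega> x \<le> stable_norm T \<omega> (a *\<^sub>R x)" using assms by simp
qed

lemma stable_norm_semigroup:
  assumes s: "s \<ge> 0"
  shows "stable_norm T \<omega> (T s x) \<le> exp (- \<omega> * s) * stable_norm T \<omega> x"
proof (rule stable_norm_least)
  fix t :: real assume t: "t \<ge> 0"
  have "T t (T s x) = T (t + s) x"
    using semigroup s t by (simp add: strongly_continuous_semigroup_def)
  then have "exp (\<omega> * t) * norm (T t (T s x))
      = exp (- \<omega> * s) * (exp (\<omega> * (t + s)) * norm (T (t + s) x))"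
    by (simp add: distrib_left exp_add exp_minus)
  also have "\<dots> \<le> exp (- \<omega> * s) * stable_norm T \<omega> x"
    using stable_norm_ge[of "t + s"] s t by (intro mult_left_mono) auto
  finally show "exp (\<omega> * t) * norm (T t (T s x)) \<le> exp (- \<omega> * s) * stable_norm T \<omega> x" .
qed

text \<open>Write the difference quotient as \<open>g + r s\<close> with \<open>r s \<rightarrow> 0\<close>. Then
  \<open>(1 + h/s) x = (h/s) T s x + (x - h g) - h r s\<close>, and \<open>T s\<close> contracts by \<open>exp (- \<omega> s) \<le> 1 / (1 + \<omega> s)\<close>,
  which leaves the factor \<open>1 + h \<omega> / (1 + \<omega> s)\<close> in front of the norm of \<open>x\<close>; let \<open>s \<rightarrow> 0\<close>.\<close>

lemma stable_norm_dissipative: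
  assumes gen: "(x, g) \<in> generator_graph T" and h: "h > 0" and \<omega>: "\<omega> > 0"
  shows "(1 + \<omega> * h) * stable_norm T \<omega> x \<le> stable_norm T \<omega> (x - h *\<^sub>R g)"
proof -
  let ?N = "stable_norm T \<omega>"
  define r where "r s = (T s x - x) /\<^sub>R s - g" for s
  have N0: "?N x \<ge> 0" using norm_le_stable_norm[of x] norm_ge_zero order_trans by blast
  have r0: "(r \<longlongrightarrow> 0) (at_right 0)"
    using gen tendsto_diff[OF _ tendsto_const[of g]]
    unfolding generator_graph_def r_def by fastforce
  have ineq: "(1 + h * (\<omega> / (1 + \<omega> * s))) * ?N x \<le> ?N (x - h *\<^sub>R g) + h * (c * norm (r s))"
    if s: "s > 0" for s
  proof -
    have "(1 + h / s) *\<^sub>R x = (h / s) *\<^sub>R T s x + ((x - h *\<^sub>R g) + h *\<^sub>R (- r s))"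
      using s by (simp add: r_def algebra_simps divide_inverse)
    then have "(1 + h / s) * ?N x \<le> ?N ((h / s) *\<^sub>R T s x) + ?N ((x - h *\<^sub>R g) + h *\<^sub>R (- r s))"
      using stable_norm_scale[of "1 + h / s" x] h s stable_norm_triangle by (metis add_pos_pos divide_pos_pos zero_less_one)
    also have "\<dots> \<le> ?N ((h / s) *\<^sub>R T s x) + (?N (x - h *\<^sub>R g) + ?N (h *\<^sub>R (- r s)))"
      by (intro add_left_mono stable_norm_triangle)
    also have "?N ((h / s) *\<^sub>R T s x) \<le> (h / s) * (exp (- \<omega> * s) * ?N x)"
      using stable_norm_semigroup[of s x] h s by (simp add: stable_norm_scale mult_left_mono divide_right_mono)
    also have "(h / s) * (exp (- \<omega> * s) * ?N x) \<le> (h / s) * (inverse (1 + \<omega> * s) * ?N x)"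
      using exp_ge_add_one_self[of "\<omega> * s"] \<omega> s h N0
      by (intro mult_left_mono mult_right_mono)
        (simp_all add: exp_minus le_imp_inverse_le add_pos_pos)
    also have "?N (h *\<^sub>R (- r s)) \<le> h * (c * norm (r s))"
      using stable_norm_le[of "- r s"] h unfolding stable_norm_scale[OF h] by simp
    finally have "(1 + h / s) * ?N x
        \<le> (h / s) * (inverse (1 + \<omega> * s) * ?N x) + (?N (x - h *\<^sub>R g) + h * (c * norm (r s)))"
      by simp
    moreover have "1 + h / s - (h / s) * inverse (1 + \<omega> * s) = 1 + h * (\<omega> / (1 + \<omega> * s))"
    proof -
      define q where "q = 1 + \<omega> * s"
      have "q > 0" using \<omega> s by (simp add: q_def add_pos_pos)
      then have "1 + h / s - (h / s) * inverse q = 1 + h * (\<omega> / q)"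
        using s by (simp add: divide_simps) (simp add: q_def algebra_simps)
      then show ?thesis by (simp add: q_def)
    qed
    then have "(1 + h * (\<omega> / (1 + \<omega> * s))) * ?N x
        = (1 + h / s) * ?N x - (h / s) * (inverse (1 + \<omega> * s) * ?N x)"
      by (metis left_diff_distrib mult.assoc)
    ultimately show ?thesis by linarith
  qed
  have "((\<lambda>s. (1 + h * (\<omega> / (1 + \<omega> * s))) * ?N x)
      \<longlongrightarrow> (1 + h * (\<omega> / (1 + \<omega> * 0))) * ?N x) (at_right 0)"
    by (intro tendsto_intros) auto
  moreover have "((\<lambda>s. ?N (x - h *\<^sub>R g) + h * (c * norm (r s)))
      \<longlongrightarrow> ?N (x - h *\<^sub>R g) + h * (c * norm (0 :: 'x))) (at_right 0)"
    by (intro tendsto_intros r0)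
  moreover have "\<forall>\<^sub>F s in at_right 0. (1 + h * (\<omega> / (1 + \<omega> * s))) * ?N x
      \<le> ?N (x - h *\<^sub>R g) + h * (c * norm (r s))"
    using eventually_at_right_less[of "0::real"] by eventually_elim (rule ineq)
  ultimately have "(1 + h * (\<omega> / (1 + \<omega> * 0))) * ?N x
      \<le> ?N (x - h *\<^sub>R g) + h * (c * norm (0 :: 'x))"
    using tendsto_le[OF trivial_limit_at_right_real] by blast
  then show ?thesis by (simp add: mult.commute)
qed

end

text \<open>Subtracting the stationary value \<open>b / \<omega>\<close> makes the recursion homogeneous. Bernoulli's inequality
  turns the geometric decay into a bound that depends only on the elapsed time \<open>(n - k0) h\<close>; a rate
  \<open>1/t\<close> instead of an exponential one is enough for convergence.\<close>

lemma discrete_gronwall: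
  fixes p :: "nat \<Rightarrow> real"
  assumes step: "\<And>k. k0 \<le> k \<Longrightarrow> k < n \<Longrightarrow> (1 + \<omega> * h) * p (Suc k) \<le> p k + h * b"
    and \<omega>: "\<omega> > 0" and h: "h > 0" and b: "b \<ge> 0" and p0: "p k0 \<ge> 0" and "k0 \<le> n"
  shows "p n \<le> b / \<omega> + p k0 / (1 + \<omega> * (real (n - k0) * h))"
proof -
  have q: "(1 + \<omega> * h) ^ m * (p (k0 + m) - b / \<omega>) \<le> p k0" if "k0 + m \<le> n" for m
    using that
  proof (induction m)
    case 0
    then show ?case using b \<omega> by simp
  next
    case (Suc m)
    have "(1 + \<omega> * h) * (p (Suc (k0 + m)) - b / \<omega>) \<le> p (k0 + m) - b / \<omega>"
      using step[of "k0 + m"] Suc.prems \<omega> by (simp add: algebra_simps)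
    then have "(1 + \<omega> * h) ^ m * ((1 + \<omega> * h) * (p (Suc (k0 + m)) - b / \<omega>))
        \<le> (1 + \<omega> * h) ^ m * (p (k0 + m) - b / \<omega>)"
      using \<omega> h by (intro mult_left_mono) auto
    then show ?case using Suc by (simp add: mult_ac)
  qed
  let ?m = "n - k0"
  have pos: "0 < 1 + \<omega> * (real ?m * h)" using \<omega> h by (simp add: add_pos_nonneg)
  have bern: "1 + \<omega> * (real ?m * h) \<le> (1 + \<omega> * h) ^ ?m"
    using Bernoulli_inequality[of "\<omega> * h" ?m] \<omega> h mult_pos_pos[OF \<omega> h]
    by (simp add: mult_ac)
  have "p n - b / \<omega> \<le> p k0 / (1 + \<omega> * h) ^ ?m"
    using q[of ?m] \<open>k0 \<le> n\<close> \<omega> h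
    by (simp add: pos_le_divide_eq mult.commute add_pos_pos)
  also have "\<dots> \<le> p k0 / (1 + \<omega> * (real ?m * h))"
    using bern pos p0 by (intro divide_left_mono) auto
  finally show ?thesis by simp
qed

section \<open>The saturated closed loop\<close>

context
  fixes D :: "'x::{real_inner, banach} set"
    and A :: "'x \<Rightarrow> 'x"
    and B :: "'u::{real_inner, banach} \<Rightarrow>\<^sub>L 'x"
    and F :: "'u set" and xs :: 'x and us :: 'u
  assumes lin: "linear_operator D A" and mm: "maximal_monotone D A"
    and F: "closed F" "convex F" and us: "us \<in> F"
begin

lemma closed_loop_monotone:
  assumes "x \<in> D" "z \<in> D"
  shows "(closed_loop A B F xs us x - closed_loop A B F xs us z) \<bullet> (x - z) \<ge> 0"
proof -
  let ?B = "adjoint (blinfun_apply B)"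
  have F0: "F \<noteq> {}" using us by blast
  define a where "a = us - ?B (x - xs)"
  define b where "b = us - ?B (z - xs)"
  have ab: "?B (x - z) = - (a - b)"
    by (simp add: a_def b_def linear_diff[OF linear_blinfun_adjoint])
  have "closed_loop A B F xs us x - closed_loop A B F xs us z
      = (A x - A z) - B (metric_projection F a - metric_projection F b)"
    by (simp add: closed_loop_def a_def b_def blinfun.diff_right)
  then have "(closed_loop A B F xs us x - closed_loop A B F xs us z) \<bullet> (x - z)
      = (A x - A z) \<bullet> (x - z) + (metric_projection F a - metric_projection F b) \<bullet> (a - b)"
    by (simp add: inner_diff_left[of "A x - A z"] blinfun_adjoint ab)
       (simp add: inner_diff_right)
  moreover have "0 \<le> (metric_projection F a - metric_projection F b) \<bullet> (a - b)"
    using metric_projection_firmly_nonexpansive[OF F F0, of a b] zero_le_power2 order_trans by blast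
  ultimately show ?thesis using maximal_monotoneD[OF mm assms] by simp
qed

lemma closed_loop_range:
  assumes h: "0 < h" "h * (norm B)\<^sup>2 < 1"
  shows "\<exists>x\<in>D. x + h *\<^sub>R closed_loop A B F xs us x = y"
proof -
  let ?B = "adjoint (blinfun_apply B)"
  have F0: "F \<noteq> {}" using us by blast
  let ?N = "\<lambda>x. - B (metric_projection F (us - ?B (x - xs)))"
  have "norm (?N x - ?N z) \<le> (norm B)\<^sup>2 * norm (x - z)" for x z
  proof -
    let ?a = "us - ?B (x - xs)" and ?b = "us - ?B (z - xs)"
    have "norm (?N x - ?N z) = norm (B (metric_projection F ?a - metric_projection F ?b))"
      by (simp add: blinfun.diff_right norm_minus_commute)
    also have "\<dots> \<le> norm B * norm (metric_projection F ?a - metric_projection F ?b)"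
      by (rule norm_blinfun)
    also have "\<dots> \<le> norm B * norm (?a - ?b)"
      by (intro mult_left_mono metric_projection_nonexpansive[OF F F0]) simp
    also have "?a - ?b = - ?B (x - z)"
      by (simp add: linear_diff[OF linear_blinfun_adjoint])
    also have "norm B * norm (- ?B (x - z)) \<le> norm B * (norm B * norm (x - z))"
      unfolding norm_minus_cancel by (intro mult_left_mono norm_blinfun_adjoint_le) simp
    finally show ?thesis by (simp add: power2_eq_square mult.assoc)
  qed
  from lipschitz_perturbation_range[OF maximal_monotoneD[OF mm]
      linear_maximal_monotone_range[OF lin mm h(1)] this h]
  show ?thesis by (simp add: closed_loop_def)
qed

text \<open>With \<open>z = x - xs\<close>, \<open>g = - A z + L B\<^sup>* z\<close> and \<open>f = B (P\<^sub>F (us - B\<^sup>* z) - us) - L B\<^sup>* z\<close> the Euler step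
  reads \<open>z - h g = (y - xs) + h f\<close>: output injection has been added to and subtracted from the closed
  loop, so that the stable generator acts on \<open>z\<close> and only outputs enter \<open>f\<close>.\<close>

lemma closed_loop_step_bound:
  fixes L :: "'u \<Rightarrow>\<^sub>L 'x"
  assumes xs: "xs \<in> D" "A xs = B us"
    and T: "generates D (\<lambda>x. - A x + L (adjoint (blinfun_apply B) x)) T"
    and decay: "\<And>t. t \<ge> 0 \<Longrightarrow> norm (T t) \<le> c * exp (- \<omega> * t)" and \<omega>: "\<omega> > 0"
    and x: "x \<in> D" "x + h *\<^sub>R closed_loop A B F xs us x = y" and h: "h > 0"
  shows "(1 + \<omega> * h) * stable_norm T \<omega> (x - xs) \<le> stable_norm T \<omega> (y - xs)
    + h * (c * ((norm L + norm B) * norm (adjoint (blinfun_apply B) (x - xs))))"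
proof -
  let ?B = "adjoint (blinfun_apply B)"
  have F0: "F \<noteq> {}" using us by blast
  have sg: "strongly_continuous_semigroup T" using T by (simp add: generates_def)
  define z where "z = x - xs"
  define g where "g = - A z + L (?B z)"
  define p where "p = metric_projection F (us - ?B z)"
  define f where "f = B (p - us) - L (?B z)"
  have sub: "subspace D" and
    add: "\<And>x y. x \<in> D \<Longrightarrow> y \<in> D \<Longrightarrow> A (x + y) = A x + A y"
    using lin by (auto simp: linear_operator_def)
  have zD: "z \<in> D" unfolding z_def by (intro subspace_diff[OF sub] x xs)
  have Ax: "A x = A z + B us" using add[OF zD xs(1)] xs(2) by (simp add: z_def)
  have "(z, g) \<in> generator_graph T"
    using T zD by (auto simp: generates_def op_graph_def g_def)
  then have "(1 + \<omega> * h) * stable_norm T \<omega> z \<le> stable_norm T \<omega> (z - h *\<^sub>R g)"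
    using stable_norm_dissipative[OF sg decay _ h \<omega>] by blast
  also have "z - h *\<^sub>R g = (y - xs) + h *\<^sub>R f"
    unfolding x(2)[symmetric] closed_loop_def Ax g_def f_def p_def
    by (simp add: z_def blinfun.diff_right algebra_simps)
  also have "stable_norm T \<omega> \<dots> \<le> stable_norm T \<omega> (y - xs) + stable_norm T \<omega> (h *\<^sub>R f)"
    by (rule stable_norm_triangle[OF sg decay])
  also have "stable_norm T \<omega> (h *\<^sub>R f) \<le> h * (c * norm f)"
    using stable_norm_scale_le[OF sg decay, of h f] stable_norm_le[OF sg decay, of f] h
    by (meson less_imp_le mult_left_mono order_trans)
  also have "norm f \<le> (norm L + norm B) * norm (?B z)"
  proof -
    have "norm (p - us) \<le> norm (?B z)"
      using metric_projection_nonexpansive[OF F F0, of "us - ?B z" us]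
      by (simp add: p_def metric_projection_fixes[OF F F0 us])
    then have "norm (B (p - us)) \<le> norm B * norm (?B z)"
      using norm_blinfun[of B "p - us"] by (meson mult_left_mono norm_ge_zero order_trans)
    then show ?thesis
      using norm_blinfun[of L "?B z"] norm_triangle_ineq4[of "B (p - us)" "L (?B z)"]
      unfolding f_def distrib_right by linarith
  qed
  finally show ?thesis
    using h order_trans[OF norm_ge_zero decay[of 0]] by (simp add: z_def mult_left_mono)
qed

lemma closed_loop_equilibrium:
  assumes "A xs = B us"
  shows "closed_loop A B F xs us xs = 0"
proof -
  have F0: "F \<noteq> {}" using us by blast
  show ?thesis
    using assms by (simp add: closed_loop_def linear_0[OF linear_blinfun_adjoint]
        metric_projection_fixes[OF F F0 us])
qed

text \<open>Before time \<open>\<tau>\<close> nothing is known about the output, but resolvents are nonexpansive and fix \<open>xs\<close>,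
  so the deviation has not grown when the recursion is started at the first grid point after \<open>\<tau>\<close>.
  From there on the outputs of the Euler iterates are at most \<open>2 \<epsilon>\<close>, one \<open>\<epsilon>\<close> being spent on their
  distance from the semigroup. The step lengths \<open>t / n\<close> below \<open>1\<close> put that grid point before
  \<open>\<tau> + 1\<close>.\<close>

lemma closed_loop_trajectory_bound:
  fixes L :: "'u \<Rightarrow>\<^sub>L 'x"
  assumes xs: "xs \<in> D" "A xs = B us"
    and T: "generates D (\<lambda>x. - A x + L (adjoint (blinfun_apply B) x)) T"
    and decay: "\<And>t. t \<ge> 0 \<Longrightarrow> norm (T t) \<le> c * exp (- \<omega> * t)" and \<omega>: "\<omega> > 0"
    and x0: "x0 \<in> closure D" and \<epsilon>: "\<epsilon> > 0"
    and out: "\<And>r. r \<ge> \<tau> \<Longrightarrow> norm (adjoint (blinfun_apply B)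
        (nonlinear_semigroup D (closed_loop A B F xs us) r x0 - xs)) \<le> \<epsilon>"
    and \<tau>: "\<tau> \<ge> 0" and t: "t \<ge> \<tau> + 1"
  shows "norm (nonlinear_semigroup D (closed_loop A B F xs us) t x0 - xs)
    \<le> c * ((norm L + norm B) * (2 * \<epsilon>)) / \<omega> + c * norm (x0 - xs) / (1 + \<omega> * (t - \<tau> - 1))"
proof -
  let ?B = "adjoint (blinfun_apply B)"
  let ?W = "closed_loop A B F xs us"
  let ?S = "\<lambda>r. nonlinear_semigroup D ?W r x0"
  let ?N = "stable_norm T \<omega>"
  let ?b = "c * ((norm L + norm B) * (2 * \<epsilon>))"
  let ?bound = "?b / \<omega> + c * norm (x0 - xs) / (1 + \<omega> * (t - \<tau> - 1))"
  have sg: "strongly_continuous_semigroup T" using T by (simp add: generates_def)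
  have c0: "c \<ge> 0" using order_trans[OF norm_ge_zero decay[of 0]] by simp
  have t0: "t > 0" using \<tau> t by simp
  \<comment> \<open>Small enough for the feedback, which has Lipschitz constant \<open>|B|\<^sup>2\<close>, to be absorbed.\<close>
  define h0 where "h0 = 1 / (1 + (norm B)\<^sup>2)"
  have h0: "h0 > 0" by (simp add: h0_def add_pos_nonneg)
  have range: "\<exists>x\<in>D. x + h *\<^sub>R ?W x = y" if "0 < h" "h \<le> h0" for h y
  proof (rule closed_loop_range[OF that(1)])
    have "h * (norm B)\<^sup>2 < h * (1 + (norm B)\<^sup>2)" using that by simp
    also have "\<dots> \<le> h0 * (1 + (norm B)\<^sup>2)" using that by (intro mult_right_mono) auto
    also have "\<dots> = 1" by (simp add: h0_def add_nonneg_eq_0_iff)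
    finally show "h * (norm B)\<^sup>2 < 1" .
  qed
  note exp_formula = closed_loop_monotone range h0
  \<comment> \<open>An error \<open>\<delta>\<close> in the state costs at most \<open>\<epsilon>\<close> in the output.\<close>
  define \<delta> where "\<delta> = \<epsilon> / (1 + norm B)"
  have \<delta>: "\<delta> > 0" "norm B * \<delta> \<le> \<epsilon>"
    using \<epsilon> by (simp_all add: \<delta>_def add_pos_nonneg field_simps)
  obtain y where y: "y \<in> D" "dist y x0 < \<delta> / 4"
    using x0 \<delta>(1) unfolding closure_approachable by (meson divide_pos_pos zero_less_numeral)
  have "(\<lambda>n. sqrt (t * (t / real n)) * norm (?W y)) \<longlonglongrightarrow> sqrt (t * 0) * norm (?W y)"
    by (intro tendsto_intros lim_const_over_n)
  then have "\<forall>\<^sub>F n in sequentially. sqrt (t * (t / real n)) * norm (?W y) < \<delta> / 2"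
    using \<delta>(1) by (intro order_tendstoD(2)) auto
  moreover have "\<forall>\<^sub>F n in sequentially. t / real n < 1"
    using order_tendstoD(2)[OF lim_const_over_n[of t]] by simp
  ultimately have "\<forall>\<^sub>F n in sequentially.
      norm ((resolvent (t / real n) D ?W ^^ n) x0 - xs) \<le> ?bound"
    using eventually_small_step[OF h0, of t] eventually_gt_at_top[of 0]
  proof eventually_elim
    case (elim n)
    define h where "h = t / real n"
    have h: "0 < h" "h \<le> h0" "h < 1" "real n * h = t" using elim t0 by (auto simp: h_def)
    define x where "x k = (resolvent h D ?W ^^ k) x0" for k
    have step: "x (Suc k) \<in> D" "x (Suc k) + h *\<^sub>R ?W (x (Suc k)) = x k" for k
      using resolvent_step[OF closed_loop_monotone range h(1,2), of "x k"] by (auto simp: x_def)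
    have dist: "norm (x k - xs) \<le> norm (x0 - xs)" for k
    proof (induction k)
      case (Suc k)
      have "norm (x (Suc k) - xs)
          \<le> norm ((x (Suc k) + h *\<^sub>R ?W (x (Suc k))) - (xs + h *\<^sub>R ?W xs))"
        using h step xs by (intro step_nonexpansive[OF closed_loop_monotone range]) auto
      then show ?case using Suc step(2)[of k] by (simp add: closed_loop_equilibrium[OF xs(2)])
    qed (simp add: x_def)
    have small_out: "norm (?B (x k - xs)) \<le> 2 * \<epsilon>" if "k \<le> n" "\<tau> \<le> real k * h" for k
    proof -
      have "real k * h \<le> t" using that(1) h by (metis mult_right_mono of_nat_mono less_imp_le)
      then have "sqrt (real k * h * h) \<le> sqrt (t * h)"
        using h by (intro real_sqrt_le_mono mult_right_mono) auto
      then have "sqrt (real k * h * h) * norm (?W y) < \<delta> / 2"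
        using elim(1) mult_right_mono[of "sqrt (real k * h * h)" "sqrt (t * h)" "norm (?W y)"]
        by (simp add: h_def)
      then have "norm (x k - ?S (real k * h)) \<le> \<delta>"
        using exponential_formula_rate[OF exp_formula x0 y(1) h(1,2), of k] y(2)
        by (simp add: x_def dist_norm norm_minus_commute)
      then have "norm (?B (x k - ?S (real k * h))) \<le> norm B * \<delta>"
        using norm_blinfun_adjoint_le[of B] by (meson mult_left_mono norm_ge_zero order_trans)
      moreover have "?B (x k - xs) = ?B (x k - ?S (real k * h)) + ?B (?S (real k * h) - xs)"
        by (simp flip: linear_add[OF linear_blinfun_adjoint])
      ultimately show ?thesis
        using norm_triangle_ineq[of "?B (x k - ?S (real k * h))" "?B (?S (real k * h) - xs)"]
          out[OF that(2)] \<delta>(2) by simp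
    qed
    define k0 where "k0 = nat \<lceil>\<tau> / h\<rceil>"
    have k0: "\<tau> \<le> real k0 * h" "real k0 * h < \<tau> + 1"
    proof -
      have "\<tau> / h \<ge> 0" using \<tau> h by simp
      then have "\<tau> / h \<le> real k0" "real k0 < \<tau> / h + 1"
        unfolding k0_def by linarith+
      then have "\<tau> \<le> real k0 * h" "real k0 * h < \<tau> + h"
        using h by (auto simp: field_simps)
      then show "\<tau> \<le> real k0 * h" "real k0 * h < \<tau> + 1" using h by auto
    qed
    have "k0 \<le> n"
    proof (rule ccontr)
      assume "\<not> k0 \<le> n"
      then have "real n * h \<le> real k0 * h" using h by (intro mult_right_mono) auto
      then show False using k0 h t by linarith
    qed
    have "norm (x n - xs) \<le> ?N (x n - xs)" by (rule norm_le_stable_norm[OF sg decay])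
    also have "\<dots> \<le> ?b / \<omega> + ?N (x k0 - xs) / (1 + \<omega> * (real (n - k0) * h))"
    proof (rule discrete_gronwall)
      fix k assume k: "k0 \<le> k" "k < n"
      have "real k0 * h \<le> real (Suc k) * h" using k h by (intro mult_right_mono) auto
      then have "norm (?B (x (Suc k) - xs)) \<le> 2 * \<epsilon>"
        using k k0 by (intro small_out) auto
      then have "h * (c * ((norm L + norm B) * norm (?B (x (Suc k) - xs)))) \<le> h * ?b"
        using h c0 by (intro mult_left_mono) auto
      then show "(1 + \<omega> * h) * ?N (x (Suc k) - xs) \<le> ?N (x k - xs) + h * ?b"
        using closed_loop_step_bound[OF xs T decay \<omega> step h(1), of k] by linarith
    next
      show "?N (x k0 - xs) \<ge> 0"
        using norm_le_stable_norm[OF sg decay] norm_ge_zero order_trans by blast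
    qed (use \<omega> h c0 \<epsilon> \<open>k0 \<le> n\<close> in auto)
    also have "?N (x k0 - xs) / (1 + \<omega> * (real (n - k0) * h))
        \<le> c * norm (x0 - xs) / (1 + \<omega> * (t - \<tau> - 1))"
    proof (rule frac_le)
      show "?N (x k0 - xs) \<le> c * norm (x0 - xs)"
        using stable_norm_le[OF sg decay, of "x k0 - xs"] mult_left_mono[OF dist c0, of k0]
        by linarith
      show "0 < 1 + \<omega> * (t - \<tau> - 1)" using \<omega> t by (simp add: add_pos_nonneg)
      have "real (n - k0) * h = t - real k0 * h"
        using \<open>k0 \<le> n\<close> h(4) by (simp add: of_nat_diff left_diff_distrib)
      then show "1 + \<omega> * (t - \<tau> - 1) \<le> 1 + \<omega> * (real (n - k0) * h)"
        using \<omega> k0 by (intro add_left_mono mult_left_mono) auto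
    qed (use c0 in simp)
    finally show ?case by (simp add: x_def h_def)
  qed
  moreover have "(\<lambda>n. norm ((resolvent (t / real n) D ?W ^^ n) x0 - xs))
      \<longlonglongrightarrow> norm (?S t - xs)"
    by (intro tendsto_intros exponential_formula_converges[OF exp_formula x0 t0])
  ultimately show ?thesis
    using tendsto_upperbound[OF _ _ sequentially_bot] by blast
qed

end

theorem proposition3p9:
  fixes D :: "'x::{real_inner, banach} set"
    and A :: "'x \<Rightarrow> 'x"
    and B :: "'u::{real_inner, banach} \<Rightarrow>\<^sub>L 'x"
    and F :: "'u set"
    and xs :: 'x and us :: 'u
  assumes "linear_operator D A"
    and "maximal_monotone D A"
    and "closed F" and "convex F"
    and "xs \<in> D" and "us \<in> interior F"
    and "- A xs + B us = 0"
    and "exponentially_detectable D A B"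
  shows "VOVS D (closed_loop A B F xs us) B xs"
  unfolding VOVS_def
proof (intro ballI impI)
  let ?S = "nonlinear_semigroup D (closed_loop A B F xs us)"
  fix x0 assume x0: "x0 \<in> closure D"
    and out: "((\<lambda>t. adjoint (blinfun_apply B) (?S t x0 - xs)) \<longlongrightarrow> 0) at_top"
  have us: "us \<in> F" and eq: "A xs = B us"
    using assms(6,7) interior_subset by (auto simp: algebra_simps)
  obtain L :: "'u \<Rightarrow>\<^sub>L 'x" and T c \<omega>
    where T: "generates D (\<lambda>x. - A x + L (adjoint (blinfun_apply B) x)) T"
      and c: "c \<ge> 1" and \<omega>: "\<omega> > 0"
      and decay: "\<And>t. t \<ge> 0 \<Longrightarrow> norm (T t) \<le> c * exp (- \<omega> * t)"
    using assms(8) unfolding exponentially_detectable_def exponentially_stable_def by blast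
  show "((\<lambda>t. ?S t x0) \<longlongrightarrow> xs) at_top"
  proof (rule tendstoI)
    fix e :: real assume e: "e > 0"
    define K where "K = c * (norm L + norm B) * 2 / \<omega>"
    \<comment> \<open>\<open>K \<epsilon>\<close> is the asymptotic bound for outputs below \<open>\<epsilon>\<close>; it takes one half of \<open>e\<close>, the decaying
      contribution of the initial state the other.\<close>
    define \<epsilon> where "\<epsilon> = e / (2 * (K + 1))"
    have K: "K \<ge> 0" using c \<omega> by (simp add: K_def)
    then have \<epsilon>: "\<epsilon> > 0" "K * \<epsilon> < e / 2" using e by (simp_all add: \<epsilon>_def field_simps)
    from out \<epsilon>(1) obtain \<tau>0 where
      "\<And>r. r \<ge> \<tau>0 \<Longrightarrow> norm (adjoint (blinfun_apply B) (?S r x0 - xs)) < \<epsilon>"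
      by (auto simp: tendsto_iff eventually_at_top_linorder)
    then have small: "norm (adjoint (blinfun_apply B) (?S r x0 - xs)) \<le> \<epsilon>"
      if "r \<ge> max \<tau>0 0" for r using that by (simp add: less_imp_le)
    define \<tau> where "\<tau> = max \<tau>0 0"
    have "filterlim (\<lambda>t. \<omega> * ((- \<tau> - 1) + t)) at_top at_top"
      by (intro filterlim_tendsto_pos_mult_at_top[OF tendsto_const \<omega>]
          filterlim_tendsto_add_at_top[OF tendsto_const] filterlim_ident)
    then have "\<forall>\<^sub>F t in at_top. \<omega> * ((- \<tau> - 1) + t) \<ge> 2 * (c * norm (x0 - xs)) / e"
      unfolding filterlim_at_top by blast
    then show "\<forall>\<^sub>F t in at_top. dist (?S t x0) xs < e"
      using eventually_ge_at_top[of "\<tau> + 1"]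
    proof eventually_elim
      case (elim t)
      have "norm (?S t x0 - xs)
          \<le> c * ((norm L + norm B) * (2 * \<epsilon>)) / \<omega> + c * norm (x0 - xs) / (1 + \<omega> * (t - \<tau> - 1))"
        by (rule closed_loop_trajectory_bound[OF assms(1-4) us assms(5) eq T decay \<omega> x0 \<epsilon>(1)])
           (use small elim in \<open>auto simp: \<tau>_def\<close>)
      also have "c * ((norm L + norm B) * (2 * \<epsilon>)) / \<omega> = K * \<epsilon>" by (simp add: K_def)
      also have "c * norm (x0 - xs) / (1 + \<omega> * (t - \<tau> - 1)) \<le> e / 2"
      proof -
        have pos: "0 < 1 + \<omega> * (t - \<tau> - 1)" using \<omega> elim by (simp add: add_pos_nonneg)
        have "c * norm (x0 - xs) \<le> e / 2 * (\<omega> * (t - \<tau> - 1))"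
          using elim(1) e by (simp add: field_simps)
        also have "\<dots> \<le> e / 2 * (1 + \<omega> * (t - \<tau> - 1))" using e by (intro mult_left_mono) auto
        finally show ?thesis using pos by (simp add: pos_divide_le_eq)
      qed
      finally show ?case using \<epsilon>(2) by (simp add: dist_norm)
    qed
  qed
qed

end
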